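(* For the submodular maximization problem with an unknown knapsack capacity restricted to instances in which every item has size $1$, no deterministic policy achieves a robustness ratio better than $(1+\sqrt5)/4$, and no randomized policy achieves a robustness ratio better than $(5+\sqrt5)/8$. That is, for every $\alpha>(1+\sqrt5)/4$ there is an instance with only unit-size items for which no deterministic adaptive policy is $\alpha$-robust, and for every $\alpha>(5+\sqrt5)/8$ there is an instance with only unit-size items for which no randomized adaptive policy is $\alpha$-robust.
   Context: Submodular maximization problem with an unknown knapsack capacity: an instance is a finite set $I$ of items with positive integer sizes $s(i)$ and a monotone submodular function $f\colon 2^I\to\mathbb{R}_+$ with $f(\emptyset)=0$. The capacity $C$ is unknown. Items are tried one at a time, each at most once. When item $i$ is tried and the current knapsack content is $X$, we learn whether $s(X)+s(i)\le C$, where $s(X)=\sum_{j\in X}s(j)$. If so, $i$ is irrevocably added to $X$; otherwise $i$ is discarded, and the process continues with the remaining items (if cancellation is allowed) or stops (if not). When all sizes are $1$, once one item does not fit no other item fits, so the output does not depend on whether cancellation is allowed. A (deterministic) adaptive policy is a binary decision tree specifying the next item to try depending on the observations so far; a randomized policy is a probability distribution over such trees. No computational restriction is imposed on policies. Let $\mathrm{ALG}_C$ be the (possibly random) output when the capacity is $C$ and let $\mathrm{OPT}_C$ maximize $f(X)$ over $X\subseteq I$ with $s(X)\le C$. The policy is $\alpha$-robust if $\mathbb{E}[f(\mathrm{ALG}_C)]\ge\alpha f(\mathrm{OPT}_C)$ for every $C\in\mathbb{R}_+$. *)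

theory Defs
  imports "HOL-Probability.Probability"
begin

definition monotone_set_fun :: "'a set \<Rightarrow> ('a set \<Rightarrow> real) \<Rightarrow> bool" where
  "monotone_set_fun I f \<longleftrightarrow> (\<forall>X Y. X \<subseteq> Y \<and> Y \<subseteq> I \<longrightarrow> f X \<le> f Y)"

definition submodular :: "'a set \<Rightarrow> ('a set \<Rightarrow> real) \<Rightarrow> bool" where
  "submodular I f \<longleftrightarrow>
     (\<forall>X Y. X \<subseteq> I \<and> Y \<subseteq> I \<longrightarrow> f (X \<union> Y) + f (X \<inter> Y) \<le> f X + f Y)"

definition knapsack_instance :: "'a set \<Rightarrow> ('a \<Rightarrow> nat) \<Rightarrow> ('a set \<Rightarrow> real) \<Rightarrow> bool" where
  "knapsack_instance I s f \<longleftrightarrow>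
     finite I \<and> (\<forall>i\<in>I. s i > 0) \<and> (\<forall>X. X \<subseteq> I \<longrightarrow> f X \<ge> 0) \<and> f {} = 0 \<and>
     monotone_set_fun I f \<and> submodular I f"

definition unit_size :: "'a set \<Rightarrow> ('a \<Rightarrow> nat) \<Rightarrow> bool" where
  "unit_size I s \<longleftrightarrow> (\<forall>i\<in>I. s i = 1)"

definition opt :: "'a set \<Rightarrow> ('a \<Rightarrow> nat) \<Rightarrow> ('a set \<Rightarrow> real) \<Rightarrow> real \<Rightarrow> real" where
  "opt I s f C = Max (f ` {X. X \<subseteq> I \<and> real (sum s X) \<le> C})"

text \<open>
  In \<open>Try i l r\<close> the item \<open>i\<close> is tried; the process continues with \<open>l\<close> if it fits and
  with \<open>r\<close> if it does not. A policy may stop before all items have been tried.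
\<close>
datatype 'a policy = Stop | Try 'a "'a policy" "'a policy"

text \<open>On every path of the tree, each item is tried at most once.\<close>
primrec valid_policy :: "'a set \<Rightarrow> 'a policy \<Rightarrow> bool" where
  "valid_policy I Stop \<longleftrightarrow> True"
| "valid_policy I (Try i l r) \<longleftrightarrow>
     i \<in> I \<and> valid_policy (I - {i}) l \<and> valid_policy (I - {i}) r"

text \<open>
  Final knapsack content when a policy is run from content \<open>X\<close> with capacity \<open>C\<close>. The flag \<open>canc\<close>
  tells whether cancellation is allowed; if it is not, the first item that does not fit ends
  the process and the \<open>r\<close> subtrees are irrelevant.
\<close>
primrec run :: "bool \<Rightarrow> ('a \<Rightarrow> nat) \<Rightarrow> real \<Rightarrow> 'a set \<Rightarrow> 'a policy \<Rightarrow> 'a set" where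
  "run canc s C X Stop = X"
| "run canc s C X (Try i l r) =
     (if real (sum s X) + real (s i) \<le> C then run canc s C (insert i X) l
      else if canc then run canc s C X r
      else X)"

definition alg :: "bool \<Rightarrow> ('a \<Rightarrow> nat) \<Rightarrow> real \<Rightarrow> 'a policy \<Rightarrow> 'a set" where
  "alg canc s C t = run canc s C {} t"

definition det_robust ::
  "bool \<Rightarrow> 'a set \<Rightarrow> ('a \<Rightarrow> nat) \<Rightarrow> ('a set \<Rightarrow> real) \<Rightarrow> real \<Rightarrow> 'a policy \<Rightarrow> bool" where
  "det_robust canc I s f \<alpha> t \<longleftrightarrow>
     (\<forall>C\<ge>0. f (alg canc s C t) \<ge> \<alpha> * opt I s f C)"

text \<open>
  For finite \<open>I\<close> there are only finitely many valid policies, so probability mass functions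
  cover all probability distributions over them, and every expectation below is a finite sum.
\<close>
definition valid_randomized_policy :: "'a set \<Rightarrow> 'a policy pmf \<Rightarrow> bool" where
  "valid_randomized_policy I p \<longleftrightarrow> (\<forall>t\<in>set_pmf p. valid_policy I t)"

definition rand_robust ::
  "bool \<Rightarrow> 'a set \<Rightarrow> ('a \<Rightarrow> nat) \<Rightarrow> ('a set \<Rightarrow> real) \<Rightarrow> real \<Rightarrow> 'a policy pmf \<Rightarrow> bool" where
  "rand_robust canc I s f \<alpha> p \<longleftrightarrow>
     (\<forall>C\<ge>0. measure_pmf.expectation p (\<lambda>t. f (alg canc s C t)) \<ge> \<alpha> * opt I s f C)"

end

theory Submission imports Defs begin

text \<open>
  Let \<open>\<rho> = (1 + sqrt 5) / 4\<close>, the positive root of \<open>2\<rho>\<^sup>2 = \<rho> + 1/2\<close>. Items 1 and 2 cover disjoint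
  regions of weight \<open>\<rho>\<close>, and item 0 covers weight \<open>1/2\<close> of each of them. Item 0 is optimal for
  capacity 1, where the other items only achieve the ratio \<open>\<rho>\<close>. The pair \<open>{1, 2}\<close> is optimal for
  capacity 2, where any pair containing 0 has value \<open>\<rho> + 1/2\<close>, hence ratio \<open>\<rho>\<close> as well. The first
  item tried decides which of the two capacities is served badly, so the two ratios of a
  deterministic policy sum to at most \<open>1 + \<rho>\<close>; averaging, one of the two ratios of a randomized
  policy is at most \<open>(1 + \<rho>) / 2\<close>.
\<close>

lemma opt_ge:
  assumes "finite I" "X \<subseteq> I" "real (sum s X) \<le> C"
  shows "f X \<le> opt I s f C"
  unfolding opt_def using assms by (intro Max_ge) auto

lemma run_superset: "X \<subseteq> run canc s C X t"
proof (induction t arbitrary: X)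
  case (Try i l r)
  have "X \<subseteq> run canc s C (insert i X) l"
    using Try.IH(1)[of "insert i X"] by blast
  then show ?case
    using Try.IH(2)[of X] by auto
qed simp

lemma run_subset: "valid_policy I t \<Longrightarrow> run canc s C X t \<subseteq> X \<union> I"
proof (induction t arbitrary: X I)
  case (Try i l r)
  have "run canc s C (insert i X) l \<subseteq> X \<union> I"
    using Try.IH(1)[of "I - {i}" "insert i X"] Try.prems by auto
  moreover have "run canc s C X r \<subseteq> X \<union> I"
    using Try.IH(2)[of "I - {i}" X] Try.prems by auto
  ultimately show ?case by auto
qed simp

lemma run_unit_card:
  "real (card X) \<le> C \<Longrightarrow> real (card (run canc (\<lambda>_. 1) C X t)) \<le> C"
proof (induction t arbitrary: X)
  case (Try i l r)
  have "real (card (insert i X)) \<le> C" if "real (card X) + 1 \<le> C"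
    using that card_insert_le_m1[of "card X + 1" X i] by simp
  then show ?case
    using Try by auto
qed simp

text \<open>A full knapsack rejects every further unit item, so the content stays frozen in both
  cancellation modes.\<close>

lemma run_unit_full:
  "C < real (card X) + 1 \<Longrightarrow> run canc (\<lambda>_. 1) C X t = X"
  by (induction t) auto

definition gap_ratio :: real where
  "gap_ratio = (1 + sqrt 5) / 4"

lemma gap_ratio_bounds: "1 / 2 < gap_ratio" "gap_ratio < 1"
  by (simp_all add: gap_ratio_def real_less_lsqrt real_less_rsqrt)

lemma gap_ratio_square: "2 * gap_ratio * gap_ratio = gap_ratio + 1 / 2"
  by (simp add: gap_ratio_def field_simps)

text \<open>Weighted coverage of four cells: items 1 and 2 each have a cell of weight 1/2 shared
  with item 0 and a private cell of weight \<open>gap_ratio - 1/2\<close>.\<close>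

definition gap_fun :: "nat set \<Rightarrow> real" where
  "gap_fun X = (of_bool (0 \<in> X \<or> 1 \<in> X) + of_bool (0 \<in> X \<or> 2 \<in> X)) / 2
     + (gap_ratio - 1 / 2) * (of_bool (1 \<in> X) + of_bool (2 \<in> X))"

lemma gap_fun_nonneg: "0 \<le> gap_fun X"
  using gap_ratio_bounds by (simp add: gap_fun_def)

lemma gap_fun_mono: "X \<subseteq> Y \<Longrightarrow> gap_fun X \<le> gap_fun Y"
  using gap_ratio_bounds unfolding gap_fun_def
  by (intro add_mono mult_left_mono divide_right_mono) auto

text \<open>Each cell contributes the indicator that \<open>X\<close> meets a fixed set of items,
  which is submodular, and all weights are nonnegative.\<close>

lemma gap_fun_submodular:
  "gap_fun (X \<union> Y) + gap_fun (X \<inter> Y) \<le> gap_fun X + gap_fun Y"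
  using gap_ratio_bounds by (simp add: gap_fun_def of_bool_def)

lemma gap_instance: "knapsack_instance {0, 1, 2} (\<lambda>_. 1) gap_fun"
  using gap_fun_nonneg gap_fun_mono gap_fun_submodular
  by (auto simp: knapsack_instance_def monotone_set_fun_def submodular_def)
     (simp add: gap_fun_def)

lemma gap_fun_le: "gap_fun X \<le> 2 * gap_ratio"
  using gap_ratio_bounds by (simp add: gap_fun_def of_bool_def)

text \<open>Lower bounds suffice, since robustness is to be refuted; the witnesses are
  \<open>{0}\<close> and \<open>{1, 2}\<close>.\<close>

lemma gap_opt:
  "1 \<le> opt {0, 1, 2} (\<lambda>_. 1) gap_fun 1"
  "2 * gap_ratio \<le> opt {0, 1, 2} (\<lambda>_. 1) gap_fun 2"
  using opt_ge[of "{0, 1, 2}" "{0}" "\<lambda>_. 1" 1 gap_fun]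
    opt_ge[of "{0, 1, 2}" "{1, 2}" "\<lambda>_. 1" 2 gap_fun]
  by (simp_all add: gap_fun_def)

text \<open>Beside item 0 there is room for one more item, hence for one private cell: the value is
  at most \<open>1 + (gap_ratio - 1/2)\<close>, which \<open>gap_ratio_square\<close>
  rewrites.\<close>

lemma gap_fun_pair:
  assumes "X \<subseteq> {0, 1, 2}" "card X \<le> 2" "0 \<in> X"
  shows "gap_fun X \<le> 2 * gap_ratio * gap_ratio"
proof -
  have "\<not> (1 \<in> X \<and> 2 \<in> X)"
  proof
    assume "1 \<in> X \<and> 2 \<in> X"
    with assms have "X = {0, 1, 2}" by auto
    with assms show False by simp
  qed
  then show ?thesis
    using gap_ratio_bounds assms(3) unfolding gap_ratio_square
    by (auto simp: gap_fun_def)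
qed

text \<open>The root of the tree is tried before anything is observed, so the same first item is
  packed at both capacities. Item 0 spoils capacity 2; any other item, or stopping at once, spoils
  capacity 1.\<close>

lemma gap_policy_cases:
  assumes "valid_policy {0, 1, 2} t"
  shows "gap_fun (alg canc (\<lambda>_. 1) 1 t) \<le> 1 \<and>
           gap_fun (alg canc (\<lambda>_. 1) 2 t) \<le> 2 * gap_ratio * gap_ratio
       \<or> gap_fun (alg canc (\<lambda>_. 1) 1 t) \<le> gap_ratio"
proof (cases t)
  case Stop
  then show ?thesis
    using gap_ratio_bounds by (simp add: alg_def gap_fun_def)
next
  case (Try i l r)
  define A where "A = run canc (\<lambda>_. 1) 2 {i} l"
  have alg1: "alg canc (\<lambda>_. 1) 1 t = {i}"
    by (simp add: alg_def Try run_unit_full del: One_nat_def)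
  have alg2: "alg canc (\<lambda>_. 1) 2 t = A"
    by (simp add: alg_def Try A_def)
  show ?thesis
  proof (cases "i = 0")
    case True
    have "A \<subseteq> {0, 1, 2}"
      using run_subset[of "{0, 1, 2} - {i}" l canc "\<lambda>_. 1" 2 "{i}"] assms
      by (auto simp: Try A_def)
    moreover have "card A \<le> 2"
      using run_unit_card[of "{i}" 2 canc l] by (simp add: A_def)
    moreover have "0 \<in> A"
      using run_superset[of "{i}" canc "\<lambda>_. 1" 2 l] True by (simp add: A_def)
    ultimately show ?thesis
      using gap_fun_pair[of A] True unfolding alg1 alg2 by (simp add: gap_fun_def)
  next
    case False
    then have "gap_fun {i} \<le> gap_ratio"
      using gap_ratio_bounds by (simp add: gap_fun_def of_bool_def)
    then show ?thesis
      unfolding alg1 by simp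
  qed
qed

lemma gap_det_robust_le:
  assumes "valid_policy {0, 1, 2} t" "det_robust canc {0, 1, 2} (\<lambda>_. 1) gap_fun \<alpha> t"
    and "0 \<le> \<alpha>"
  shows "\<alpha> \<le> gap_ratio"
proof -
  have "\<alpha> * opt {0, 1, 2} (\<lambda>_. 1) gap_fun C \<le> gap_fun (alg canc (\<lambda>_. 1) C t)" if "0 \<le> C" for C
    using assms(2) that by (simp add: det_robust_def)
  from this[of 1] this[of 2]
  have "\<alpha> * 1 \<le> gap_fun (alg canc (\<lambda>_. 1) 1 t)"
    and "\<alpha> * (2 * gap_ratio) \<le> gap_fun (alg canc (\<lambda>_. 1) 2 t)"
    using mult_left_mono[OF gap_opt(1) assms(3)] mult_left_mono[OF gap_opt(2) assms(3)]
    by linarith+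
  \<comment> \<open>The right disjunct comes from capacity 2 and still carries the factor
    \<open>2 * gap_ratio\<close>, the optimum there.\<close>
  with gap_policy_cases[OF assms(1), of canc]
  have "\<alpha> \<le> gap_ratio \<or> \<alpha> * (2 * gap_ratio) \<le> gap_ratio * (2 * gap_ratio)"
    by (auto simp: mult_ac simp del: One_nat_def)
  then show ?thesis
    using gap_ratio_bounds by (simp add: mult_le_cancel_right_pos)
qed

lemma gap_rand_robust_le:
  assumes "valid_randomized_policy {0, 1, 2} p"
    and "rand_robust canc {0, 1, 2} (\<lambda>_. 1) gap_fun \<alpha> p"
    and "0 \<le> \<alpha>"
  shows "\<alpha> \<le> (1 + gap_ratio) / 2"
proof -
  define g where "g C t = gap_fun (alg canc (\<lambda>_. 1) C t)" for C t
  have integrable: "integrable (measure_pmf p) (g C)" for C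
    by (rule measure_pmf.integrable_const_bound[where B = "2 * gap_ratio"])
       (simp_all add: g_def gap_fun_le gap_fun_nonneg)
  have "\<alpha> * opt {0, 1, 2} (\<lambda>_. 1) gap_fun C \<le> measure_pmf.expectation p (g C)" if "0 \<le> C" for C
    using assms(2) that by (simp add: rand_robust_def g_def[abs_def])
  from this[of 1] this[of 2]
  have "\<alpha> * 1 \<le> measure_pmf.expectation p (g 1)"
    and "\<alpha> * (2 * gap_ratio) \<le> measure_pmf.expectation p (g 2)"
    using mult_left_mono[OF gap_opt(1) assms(3)] mult_left_mono[OF gap_opt(2) assms(3)]
    by linarith+
  \<comment> \<open>The factor \<open>2 * gap_ratio\<close> brings the capacity 1 bound to the scale
    of capacity 2, so that adding the two weighs both ratios equally.\<close>
  then have "2 * gap_ratio * \<alpha> \<le> 2 * gap_ratio * measure_pmf.expectation p (g 1)"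
    and "2 * gap_ratio * \<alpha> \<le> measure_pmf.expectation p (g 2)"
    using gap_ratio_bounds by (auto intro: mult_left_mono simp: mult_ac)
  then have "2 * gap_ratio * (2 * \<alpha>)
      \<le> 2 * gap_ratio * measure_pmf.expectation p (g 1) + measure_pmf.expectation p (g 2)"
    by (simp add: algebra_simps)
  also have "\<dots> = measure_pmf.expectation p (\<lambda>t. 2 * gap_ratio * g 1 t + g 2 t)"
    by (simp add: integrable)
  \<comment> \<open>The bound holds for every tree in the support: the ratios are at most 1 and
    \<open>gap_ratio\<close>, in one order or the other.\<close>
  also have "\<dots> \<le> measure_pmf.expectation p (\<lambda>_. 2 * gap_ratio * (1 + gap_ratio))"
  proof (rule integral_mono_AE)
    show "AE t in measure_pmf p. 2 * gap_ratio * g 1 t + g 2 t \<le> 2 * gap_ratio * (1 + gap_ratio)"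
    proof (rule AE_pmfI)
      fix t assume "t \<in> set_pmf p"
      then have "valid_policy {0, 1, 2} t"
        using assms(1) by (simp add: valid_randomized_policy_def)
      from gap_policy_cases[OF this, of canc]
      consider "g 1 t \<le> 1" "g 2 t \<le> 2 * gap_ratio * gap_ratio" | "g 1 t \<le> gap_ratio"
        by (auto simp: g_def)
      then show "2 * gap_ratio * g 1 t + g 2 t \<le> 2 * gap_ratio * (1 + gap_ratio)"
      proof cases
        case 1
        then have "2 * gap_ratio * g 1 t \<le> 2 * gap_ratio * 1"
          using gap_ratio_bounds by (intro mult_left_mono) simp_all
        with 1 show ?thesis
          by (simp add: algebra_simps)
      next
        case 2
        then have "2 * gap_ratio * g 1 t \<le> 2 * gap_ratio * gap_ratio"
          using gap_ratio_bounds by (intro mult_left_mono) simp_all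
        moreover have "g 2 t \<le> 2 * gap_ratio"
          unfolding g_def by (rule gap_fun_le)
        ultimately show ?thesis
          by (simp add: algebra_simps)
      qed
    qed
  qed (simp_all add: integrable)
  finally have "2 * gap_ratio * (2 * \<alpha>) \<le> 2 * gap_ratio * (1 + gap_ratio)"
    by simp
  then show ?thesis
    using gap_ratio_bounds by simp
qed

theorem theorem7:
  shows "(\<forall>\<alpha>::real. \<alpha> > (1 + sqrt 5) / 4 \<longrightarrow>
           (\<exists>(I :: nat set) (s :: nat \<Rightarrow> nat) (f :: nat set \<Rightarrow> real).
              knapsack_instance I s f \<and> unit_size I s \<and>
              (\<forall>canc. \<not> (\<exists>t. valid_policy I t \<and> det_robust canc I s f \<alpha> t))))
       \<and> (\<forall>\<alpha>::real. \<alpha> > (5 + sqrt 5) / 8 \<longrightarrow>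
           (\<exists>(I :: nat set) (s :: nat \<Rightarrow> nat) (f :: nat set \<Rightarrow> real).
              knapsack_instance I s f \<and> unit_size I s \<and>
              (\<forall>canc. \<not> (\<exists>p. valid_randomized_policy I p \<and> rand_robust canc I s f \<alpha> p))))"
\<comment> \<open>A single instance serves every \<open>\<alpha>\<close> in both halves.\<close>
proof (intro conjI allI impI)
  fix \<alpha> :: real
  assume "\<alpha> > (1 + sqrt 5) / 4"
  then have "gap_ratio < \<alpha>"
    by (simp add: gap_ratio_def)
  moreover from this have "0 \<le> \<alpha>"
    using gap_ratio_bounds by linarith
  ultimately have "\<forall>canc. \<not> (\<exists>t. valid_policy {0, 1, 2} t
      \<and> det_robust canc {0, 1, 2} (\<lambda>_. 1) gap_fun \<alpha> t)"
    using gap_det_robust_le by force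
  then show "\<exists>(I :: nat set) (s :: nat \<Rightarrow> nat) (f :: nat set \<Rightarrow> real).
      knapsack_instance I s f \<and> unit_size I s \<and>
      (\<forall>canc. \<not> (\<exists>t. valid_policy I t \<and> det_robust canc I s f \<alpha> t))"
    using gap_instance unfolding unit_size_def by blast
next
  fix \<alpha> :: real
  assume "\<alpha> > (5 + sqrt 5) / 8"
  \<comment> \<open>The randomized threshold is the mean of the ratios 1 and
    \<open>gap_ratio\<close>.\<close>
  moreover have "(5 + sqrt 5) / 8 = (1 + gap_ratio) / 2"
    by (simp add: gap_ratio_def field_simps)
  ultimately have "(1 + gap_ratio) / 2 < \<alpha>"
    by simp
  moreover have "0 \<le> (1 + gap_ratio) / 2"
    using gap_ratio_bounds by simp
  ultimately have "\<forall>canc. \<not> (\<exists>p. valid_randomized_policy {0, 1, 2} p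
      \<and> rand_robust canc {0, 1, 2} (\<lambda>_. 1) gap_fun \<alpha> p)"
    using gap_rand_robust_le by (meson not_le order.strict_implies_order order.trans)
  then show "\<exists>(I :: nat set) (s :: nat \<Rightarrow> nat) (f :: nat set \<Rightarrow> real).
      knapsack_instance I s f \<and> unit_size I s \<and>
      (\<forall>canc. \<not> (\<exists>p. valid_randomized_policy I p \<and> rand_robust canc I s f \<alpha> p))"
    using gap_instance unfolding unit_size_def by blast
qed

end
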